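(* Let $A\in\mathbb{R}^{m\times n}$ with $m\ge n$ have full rank and nonzero rows, let $p_1,\dots,p_m>0$ with $\sum_i p_i=1$, let $x\in\mathbb{R}^n$, let $\eta\in\mathbb{R}^m$ be a fixed (deterministic) noise vector and $y=Ax+\eta$. Run the randomized Kaczmarz algorithm on $(A,y)$ with row-selection probabilities $p_i$ from a fixed starting point $x^{(0)}\in\mathbb{R}^n$, and let $z^{(k)}=x^{(k)}-x$. Then the limiting mean squared error exists and is given by $$ \mathbb{E}\,\|z^{(\infty)}\|^2:=\lim_{k\to\infty}\mathbb{E}\,\|z^{(k)}\|^2=\operatorname{tr}\,\operatorname{mat}(v_1), $$ where $v_1=(I-Q)^{-1}\,[\,e+Dv_2\,]$ and $v_2=(I-P)^{-1}f$, with $P,Q,D,e,f$ as defined in the context.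
   Context: Randomized Kaczmarz algorithm: let $a_i\in\mathbb{R}^n$ be the (column vector of the) $i$th row of $A$. Indices $i_1,i_2,\dots$ are drawn independently, with $\Pr(i_k=i)=p_i$, and $$x^{(k)}=x^{(k-1)}+\frac{y_{i_k}-a_{i_k}^Tx^{(k-1)}}{\|a_{i_k}\|^2}\,a_{i_k}.$$ $\mathbb{E}$ denotes expectation over the random row selections only ($\eta$ and $x^{(0)}$ are fixed). Notation: $\tilde a_i=a_i/\|a_i\|$; $\tilde\eta_i=\eta_i/\|a_i\|$; $P_i^{\perp}=I_n-\tilde a_i\tilde a_i^T$; $\otimes$ is the Kronecker product; $\operatorname{vec}$ stacks the columns of a matrix vertically into a vector, and $\operatorname{mat}$ is its inverse, producing an $n\times n$ matrix from an $n^2$-dimensional vector; $I$ denotes the identity matrix of the appropriate size. Define - $P=\sum_i p_i P_i^{\perp}\in\mathbb{R}^{n\times n}$, - $Q=\sum_i p_i\,(P_i^{\perp}\otimes P_i^{\perp})\in\mathbb{R}^{n^2\times n^2}$, - $D=\sum_i p_i\tilde\eta_i\,(\tilde a_i\otimes P_i^{\perp}+P_i^{\perp}\otimes\tilde a_i)\in\mathbb{R}^{n^2\times n}$ (with $\tilde a_i$ regarded as an $n\times 1$ matrix), - $f=\sum_i p_i\tilde\eta_i\tilde a_i\in\mathbb{R}^n$, - $e=\sum_i p_i\tilde\eta_i^{2}\,(\tilde a_i\otimes\tilde a_i)\in\mathbb{R}^{n^2}$. *)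

theory Defs
  imports "HOL-Probability.Probability"
begin

text \<open>
  Kronecker products carry product index types. Under the lexicographic order on pairs, the
  pair \<open>(i, k)\<close> stands for position \<open>(i - 1) q + k\<close>, where \<open>q\<close> is the number of possible
  second components, so this is the usual block matrix with blocks \<open>A $ i $ j *\<^sub>R B\<close>.
\<close>

definition kronecker :: "real^'b^'a \<Rightarrow> real^'d^'c \<Rightarrow> real^('b \<times> 'd)^('a \<times> 'c)"
    (infixl "\<otimes>\<^sub>K" 75)
  where "A \<otimes>\<^sub>K B = (\<chi> r c. A $ fst r $ fst c * B $ snd r $ snd c)"

text \<open>
  With a one-column factor, the column index type of a Kronecker product is \<open>1 \<times> 'n\<close> or
  \<open>'n \<times> 1\<close>; renaming the columns identifies it with \<open>'n\<close>.
\<close>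

definition rename_cols :: "('c \<Rightarrow> 'b) \<Rightarrow> real^'b^'a \<Rightarrow> real^'c^'a"
  where "rename_cols g M = (\<chi> r c. M $ r $ g c)"

text \<open>
  Column stacking: entry \<open>(i, j)\<close> of the matrix goes to entry \<open>i\<close> of block \<open>j\<close>, that is to
  the index \<open>(j, i)\<close>.
\<close>

definition stack_cols :: "real^'n^'m \<Rightarrow> real^('n \<times> 'm)"
  where "stack_cols M = (\<chi> k. M $ snd k $ fst k)"

definition unstack_cols :: "real^('n \<times> 'm) \<Rightarrow> real^'n^'m"
  where "unstack_cols v = (\<chi> i j. v $ (j, i))"

lemma unstack_stack_cols [simp]: "unstack_cols (stack_cols M) = M"
  by (simp add: unstack_cols_def stack_cols_def vec_eq_iff)

lemma stack_unstack_cols [simp]: "stack_cols (unstack_cols v) = v"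
  by (simp add: unstack_cols_def stack_cols_def vec_eq_iff)

text \<open>The row used in step \<open>k \<ge> 1\<close> is \<open>rows_seq k\<close>; the value \<open>rows_seq 0\<close> is never used.\<close>

fun kaczmarz :: "real^'n^'m \<Rightarrow> real^'m \<Rightarrow> real^'n \<Rightarrow> (nat \<Rightarrow> 'm) \<Rightarrow> nat \<Rightarrow> real^'n"
  where
    "kaczmarz A y x0 rows_seq 0 = x0"
  | "kaczmarz A y x0 rows_seq (Suc k) =
       (let u = kaczmarz A y x0 rows_seq k; i = rows_seq (Suc k)
        in u + ((y $ i - (A $ i) \<bullet> u) / (norm (A $ i))\<^sup>2) *\<^sub>R (A $ i))"

definition unit_row :: "real^'n^'m \<Rightarrow> 'm \<Rightarrow> real^'n"
  where "unit_row A i = (1 / norm (A $ i)) *\<^sub>R (A $ i)"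

definition scaled_noise :: "real^'n^'m \<Rightarrow> real^'m \<Rightarrow> 'm \<Rightarrow> real"
  where "scaled_noise A \<eta> i = \<eta> $ i / norm (A $ i)"

definition col_mat :: "real^'n \<Rightarrow> real^1^'n"
  where "col_mat v = columnvector v"

definition proj_perp :: "real^'n^'m \<Rightarrow> 'm \<Rightarrow> real^'n^'n"
  where "proj_perp A i =
    mat 1 - col_mat (unit_row A i) ** transpose (col_mat (unit_row A i))"

definition mean_P :: "real^'n^'m \<Rightarrow> ('m \<Rightarrow> real) \<Rightarrow> real^'n^'n"
  where "mean_P A p = (\<Sum>i\<in>UNIV. p i *\<^sub>R proj_perp A i)"

definition mean_Q :: "real^'n^'m \<Rightarrow> ('m \<Rightarrow> real) \<Rightarrow> real^('n \<times> 'n)^('n \<times> 'n)"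
  where "mean_Q A p = (\<Sum>i\<in>UNIV. p i *\<^sub>R (proj_perp A i \<otimes>\<^sub>K proj_perp A i))"

definition mean_D :: "real^'n^'m \<Rightarrow> ('m \<Rightarrow> real) \<Rightarrow> real^'m \<Rightarrow> real^'n^('n \<times> 'n)"
  where "mean_D A p \<eta> = (\<Sum>i\<in>UNIV. (p i * scaled_noise A \<eta> i) *\<^sub>R
    (rename_cols (\<lambda>j. (1, j)) (col_mat (unit_row A i) \<otimes>\<^sub>K proj_perp A i) +
     rename_cols (\<lambda>j. (j, 1)) (proj_perp A i \<otimes>\<^sub>K col_mat (unit_row A i))))"

definition mean_f :: "real^'n^'m \<Rightarrow> ('m \<Rightarrow> real) \<Rightarrow> real^'m \<Rightarrow> real^'n"
  where "mean_f A p \<eta> = (\<Sum>i\<in>UNIV. (p i * scaled_noise A \<eta> i) *\<^sub>R unit_row A i)"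

definition mean_e :: "real^'n^'m \<Rightarrow> ('m \<Rightarrow> real) \<Rightarrow> real^'m \<Rightarrow> real^('n \<times> 'n)"
  where "mean_e A p \<eta> = (\<Sum>i\<in>UNIV. (p i * (scaled_noise A \<eta> i)\<^sup>2) *\<^sub>R
    column (1, 1) (col_mat (unit_row A i) \<otimes>\<^sub>K col_mat (unit_row A i)))"

end

theory Submission
  imports Defs
begin

text \<open>
  One step acts on the error as \<open>z \<mapsto> P\<^sub>i\<^sup>\<bottom> z + \<eta>\<^sub>i a\<^sub>i\<close> (with normalised row and noise), and the
  row used is independent of the current iterate. Hence the mean \<open>m\<^sub>k\<close> of \<open>z\<close> and the mean
  \<open>w\<^sub>k\<close> of \<open>z \<otimes> z\<close> satisfy \<open>m\<^sub>k\<^sub>+\<^sub>1 = P m\<^sub>k + f\<close> and \<open>w\<^sub>k\<^sub>+\<^sub>1 = Q w\<^sub>k + e + D m\<^sub>k\<close>. Both \<open>P\<close> and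
  \<open>Q\<close> are convex combinations, with positive weights, of orthogonal projections without a common
  nonzero fixed vector (the rows span the space), so by compactness of the unit sphere they are
  strict contractions, and the two recursions converge to their fixed points.
\<close>

subsection \<open>Affine recursions with a contracting linear part\<close>

text \<open>Once \<open>\<epsilon> k\<close> stays below \<open>(1 - c) * (r / 2)\<close>, the
  recursion is dominated by an affine map whose fixed point is \<open>r / 2\<close>, so any excess
  over \<open>r / 2\<close> decays like a power of \<open>c\<close>.\<close>

lemma contractive_recursion_tendsto_0:
  fixes d \<epsilon> :: "nat \<Rightarrow> real"
  assumes c: "0 \<le> c" "c < 1"
    and d_nonneg: "\<And>k. 0 \<le> d k"
    and step: "\<And>k. d (Suc k) \<le> c * d k + \<epsilon> k"
    and \<epsilon>: "\<epsilon> \<longlonglongrightarrow> 0"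
  shows "d \<longlonglongrightarrow> 0"
proof (rule LIMSEQ_I)
  fix r :: real assume "0 < r"
  then have "0 < (1 - c) * (r / 2)" using c by simp
  from LIMSEQ_D[OF \<epsilon> this] obtain N where N: "\<And>k. N \<le> k \<Longrightarrow> \<bar>\<epsilon> k\<bar> < (1 - c) * (r / 2)"
    by auto
  have decay: "d (N + k) \<le> c ^ k * d N + r / 2" for k
  proof (induction k)
    case 0 then show ?case using \<open>0 < r\<close> by simp
  next
    case (Suc k)
    have "d (N + Suc k) \<le> c * d (N + k) + (1 - c) * (r / 2)"
      using step[of "N + k"] N[of "N + k"] by simp
    also have "\<dots> \<le> c * (c ^ k * d N + r / 2) + (1 - c) * (r / 2)"
      using mult_left_mono[OF Suc c(1)] by simp
    also have "\<dots> = c ^ Suc k * d N + r / 2" by (simp add: field_simps)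
    finally show ?case .
  qed
  have "(\<lambda>k. c ^ k * d N) \<longlonglongrightarrow> 0 * d N"
    by (intro tendsto_intros LIMSEQ_realpow_zero c)
  then have "(\<lambda>k. c ^ k * d N) \<longlonglongrightarrow> 0" by simp
  from LIMSEQ_D[OF this, of "r / 2"] \<open>0 < r\<close>
  obtain K where K: "\<And>k. K \<le> k \<Longrightarrow> \<bar>c ^ k * d N\<bar> < r / 2" by auto
  have "norm (d n - 0) < r" if "N + K \<le> n" for n
  proof -
    from that have "n = N + (n - N)" "K \<le> n - N" by auto
    then show ?thesis
      using decay[of "n - N"] K[of "n - N"] d_nonneg[of n] by simp
  qed
  then show "\<exists>no. \<forall>n\<ge>no. norm (d n - 0) < r" by blast
qed

text \<open>A kernel vector of \<open>mat 1 - S\<close> is fixed by \<open>S\<close>, and a strict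
  contraction fixes only 0.\<close>

lemma invertible_mat1_minus_contraction:
  fixes S :: "real^'n^'n"
  assumes c: "c < 1" and contr: "\<And>w. norm (S *v w) \<le> c * norm w"
  shows "invertible (mat 1 - S)"
proof -
  have "w = 0" if "(mat 1 - S) *v w = 0" for w
  proof -
    from that have "S *v w = w" by (simp add: matrix_vector_mult_diff_rdistrib)
    with contr[of w] have "(1 - c) * norm w \<le> 0" by (simp add: algebra_simps)
    with c show ?thesis by (simp add: mult_le_0_iff)
  qed
  then show ?thesis by (auto simp: invertible_left_inverse matrix_left_invertible_ker)
qed

text \<open>Subtracting the fixed point leaves a contractive recursion perturbed by
  \<open>b k - b'\<close>. The forcing term may vary with \<open>k\<close> because the second moment
  is driven by the mean, which only converges.\<close>

lemma affine_recursion_tendsto: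
  fixes S :: "real^'n^'n" and b w :: "nat \<Rightarrow> real^'n"
  assumes c: "0 \<le> c" "c < 1" and contr: "\<And>w. norm (S *v w) \<le> c * norm w"
    and step: "\<And>k. w (Suc k) = S *v w k + b k"
    and b: "b \<longlonglongrightarrow> b'"
  shows "w \<longlonglongrightarrow> matrix_inv (mat 1 - S) *v b'"
proof -
  define w' where "w' = matrix_inv (mat 1 - S) *v b'"
  have "invertible (mat 1 - S)" by (rule invertible_mat1_minus_contraction[OF c(2) contr])
  \<comment> \<open>\<open>matrix_inv\<close> is a Hilbert choice, so its defining property has to
    be drawn from the existence of an inverse.\<close>
  then have "(mat 1 - S) ** matrix_inv (mat 1 - S) = mat 1"
    unfolding invertible_def matrix_inv_def by (rule someI2_ex) simp
  then have "(mat 1 - S) *v w' = b'"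
    by (simp add: w'_def matrix_vector_mul_assoc)
  then have fixpoint: "w' = S *v w' + b'"
    by (simp add: matrix_vector_mult_diff_rdistrib algebra_simps)
  have "(\<lambda>k. norm (w k - w')) \<longlonglongrightarrow> 0"
  proof (rule contractive_recursion_tendsto_0[OF c])
    fix k
    have "w (Suc k) - w' = S *v (w k - w') + (b k - b')"
      using step[of k] fixpoint by (simp add: matrix_vector_mult_diff_distrib algebra_simps)
    then have "norm (w (Suc k) - w') \<le> norm (S *v (w k - w')) + norm (b k - b')"
      by (metis norm_triangle_ineq)
    with contr[of "w k - w'"]
    show "norm (w (Suc k) - w') \<le> c * norm (w k - w') + norm (b k - b')" by linarith
  next
    show "(\<lambda>k. norm (b k - b')) \<longlonglongrightarrow> 0"
      using b by (simp add: tendsto_norm_zero_iff LIM_zero_iff)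
  qed simp
  then show ?thesis
    unfolding w'_def by (simp add: tendsto_norm_zero_iff LIM_zero_iff)
qed

subsection \<open>Averages of orthogonal projections\<close>

lemma sum_matrix_vector_mult:
  fixes L :: "'i \<Rightarrow> real^'n^'m"
  shows "(\<Sum>i\<in>I. L i) *v w = (\<Sum>i\<in>I. L i *v w)"
  by (induction I rule: infinite_finite_induct) (auto simp: matrix_vector_mult_add_rdistrib)

lemma mean_matrix_vector_mult:
  fixes L :: "'i \<Rightarrow> real^'n^'m"
  shows "(\<Sum>i\<in>I. p i *\<^sub>R L i) *v w = (\<Sum>i\<in>I. p i *\<^sub>R (L i *v w))"
  by (simp add: sum_matrix_vector_mult scaleR_matrix_vector_assoc)

lemma symmetric_inner_shift:
  fixes L :: "real^'n^'n"
  assumes "transpose L = L"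
  shows "(L *v u) \<bullet> w = u \<bullet> (L *v w)"
  by (metis assms dot_lmul_matrix transpose_matrix_vector)

text \<open>An orthogonal projection preserves the norm of its fixed vectors only. A nonzero vector
  is moved by some \<open>L i\<close>, which has positive weight, so the average strictly shortens
  it; compactness makes the factor uniform.\<close>

lemma mean_projection_contraction:
  fixes L :: "'i::finite \<Rightarrow> real^'n^'n"
  assumes p_pos: "\<And>i. 0 < p i" and p_sum: "(\<Sum>i\<in>UNIV. p i) = 1"
    and sym: "\<And>i. transpose (L i) = L i" and idem: "\<And>i. L i ** L i = L i"
    and no_fix: "\<And>w. (\<And>i. L i *v w = w) \<Longrightarrow> w = 0"
  shows "\<exists>c. 0 \<le> c \<and> c < 1 \<and> (\<forall>w. norm ((\<Sum>i\<in>UNIV. p i *\<^sub>R L i) *v w) \<le> c * norm w)"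
proof -
  let ?S = "\<Sum>i\<in>UNIV. p i *\<^sub>R L i"
  have norm_sq: "(L i *v w) \<bullet> (L i *v w) = w \<bullet> (L i *v w)" for i w
    using symmetric_inner_shift[OF sym, of i w "L i *v w"]
    by (simp add: matrix_vector_mul_assoc idem)
  have le: "norm (L i *v w) \<le> norm w" for i w
  proof -
    have "norm (L i *v w) * norm (L i *v w) \<le> norm w * norm (L i *v w)"
      using norm_cauchy_schwarz[of w "L i *v w"] norm_sq[of i w]
      by (simp add: dot_square_norm power2_eq_square)
    then show ?thesis
      by (cases "L i *v w = 0") auto
  qed
  \<comment> \<open>By \<open>norm_sq\<close>, the squared norm of \<open>w - L i *v w\<close> is
    the difference of the squared norms of \<open>w\<close> and \<open>L i *v w\<close>.\<close>
  have eqD: "L i *v w = w" if "norm (L i *v w) = norm w" for i w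
  proof -
    have "w \<bullet> w = (L i *v w) \<bullet> (L i *v w)" using that by (simp add: dot_square_norm)
    then have "(w - L i *v w) \<bullet> (w - L i *v w) = 0"
      using norm_sq[of i w] by (simp add: inner_diff_left inner_diff_right inner_commute)
    then show ?thesis by simp
  qed
  have strict: "norm (?S *v w) < norm w" if "w \<noteq> 0" for w
  proof -
    from that no_fix eqD le obtain i where "norm (L i *v w) < norm w"
      by (meson le_neq_trans)
    have "norm (?S *v w) \<le> (\<Sum>i\<in>UNIV. norm (p i *\<^sub>R (L i *v w)))"
      unfolding mean_matrix_vector_mult by (rule norm_sum)
    also have "\<dots> = (\<Sum>i\<in>UNIV. p i * norm (L i *v w))"
      using p_pos by (simp add: less_imp_le)
    also have "\<dots> < (\<Sum>i\<in>UNIV. p i * norm w)"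
      using \<open>norm (L i *v w) < norm w\<close> p_pos le
      by (intro sum_strict_mono_ex1) (auto intro!: mult_left_mono simp: less_imp_le)
    also have "\<dots> = norm w" by (simp add: sum_distrib_right[symmetric] p_sum)
    finally show ?thesis .
  qed
  \<comment> \<open>The contraction factor is the maximum of the norm of the image over the unit
    sphere; being attained, it lies strictly below 1.\<close>
  have "\<exists>u\<in>sphere 0 1. \<forall>v\<in>sphere 0 1. norm (?S *v v) \<le> norm (?S *v u)"
    by (intro continuous_attains_sup continuous_on_norm linear_continuous_on)
      (auto simp: compact_sphere)
  then obtain u where u: "norm u = 1" and max: "\<And>v. norm v = 1 \<Longrightarrow> norm (?S *v v) \<le> norm (?S *v u)"
    by auto
  show ?thesis
  proof (intro exI[of _ "norm (?S *v u)"] conjI allI)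
    show "norm (?S *v u) < 1" using strict[of u] u by (cases "u = 0") auto
    show "norm (?S *v w) \<le> norm (?S *v u) * norm w" for w
    proof (cases "w = 0")
      case False
      define v where "v = (1 / norm w) *\<^sub>R w"
      have w: "w = norm w *\<^sub>R v" and v: "norm v = 1" using False by (simp_all add: v_def)
      have "norm (?S *v w) = norm w * norm (?S *v v)"
        by (subst w, subst matrix_vector_mult_scaleR) simp
      also have "\<dots> \<le> norm w * norm (?S *v u)"
        by (intro mult_left_mono max v) auto
      finally show ?thesis by (simp add: mult.commute)
    qed simp
  qed simp
qed

subsection \<open>Kronecker products\<close>

text \<open>The Kronecker product of two column vectors without the one-point column index; it is
  the column stacking of the outer product of \<open>v\<close> with \<open>u\<close>.\<close>

definition kronecker_vec :: "real^'a \<Rightarrow> real^'b \<Rightarrow> real^('a \<times> 'b)"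
  where "kronecker_vec u v = (\<chi> r. u $ fst r * v $ snd r)"

lemma sum_UNIV_prod:
  fixes g :: "'a::finite \<times> 'b::finite \<Rightarrow> 'c::comm_monoid_add"
  shows "(\<Sum>r\<in>UNIV. g r) = (\<Sum>a\<in>UNIV. \<Sum>b\<in>UNIV. g (a, b))"
  by (simp add: sum.cartesian_product)

lemma kronecker_mult_kronecker_vec:
  "(A \<otimes>\<^sub>K B) *v kronecker_vec u v = kronecker_vec (A *v u) (B *v v)"
  by (simp add: vec_eq_iff kronecker_def kronecker_vec_def matrix_vector_mult_def
      sum_UNIV_prod sum_product mult_ac)

lemma kronecker_mult: "(A \<otimes>\<^sub>K B) ** (C \<otimes>\<^sub>K D) = (A ** C) \<otimes>\<^sub>K (B ** D)"
  by (simp add: vec_eq_iff kronecker_def matrix_matrix_mult_def sum_UNIV_prod sum_product mult_ac)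

lemma transpose_kronecker: "transpose (A \<otimes>\<^sub>K B) = transpose A \<otimes>\<^sub>K transpose B"
  by (simp add: vec_eq_iff kronecker_def transpose_def)

lemma kronecker_col_left:
  "rename_cols (\<lambda>j. (1, j)) (col_mat a \<otimes>\<^sub>K B) *v u = kronecker_vec a (B *v u)"
  by (simp add: vec_eq_iff kronecker_def kronecker_vec_def rename_cols_def col_mat_def
      columnvector_def matrix_vector_mult_def sum_distrib_left mult_ac)

lemma kronecker_col_right:
  "rename_cols (\<lambda>j. (j, 1)) (B \<otimes>\<^sub>K col_mat a) *v u = kronecker_vec (B *v u) a"
  by (simp add: vec_eq_iff kronecker_def kronecker_vec_def rename_cols_def col_mat_def
      columnvector_def matrix_vector_mult_def sum_distrib_left sum_distrib_right mult_ac)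

lemma column_kronecker_col_mat: "column (1, 1) (col_mat a \<otimes>\<^sub>K col_mat b) = kronecker_vec a b"
  by (simp add: vec_eq_iff kronecker_def kronecker_vec_def column_def col_mat_def columnvector_def)

text \<open>With \<open>u\<close> the projected error and \<open>t\<close> the scaled noise, the
  three summands are the sources of \<open>mean_Q\<close>, \<open>mean_D\<close> and
  \<open>mean_e\<close>.\<close>

lemma kronecker_vec_affine:
  "kronecker_vec (u + t *\<^sub>R a) (u + t *\<^sub>R a) =
    kronecker_vec u u + t *\<^sub>R (kronecker_vec a u + kronecker_vec u a) + t\<^sup>2 *\<^sub>R kronecker_vec a a"
  by (simp add: vec_eq_iff kronecker_vec_def algebra_simps power2_eq_square)

text \<open>The diagonal of the outer product of \<open>u\<close> with itself holds the squared
  entries of \<open>u\<close>. This recovers the squared error linearly from the second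
  moment.\<close>

lemma trace_unstack_kronecker_vec: "trace (unstack_cols (kronecker_vec u u)) = (norm u)\<^sup>2"
  by (simp add: trace_def unstack_cols_def kronecker_vec_def power2_norm_eq_inner inner_vec_def)

lemma bounded_linear_trace_unstack_cols:
  "bounded_linear (\<lambda>w :: real^('n::finite \<times> 'n). trace (unstack_cols w))"
  by (simp add: trace_def unstack_cols_def bounded_linear_sum bounded_linear_vec_nth)

subsection \<open>The row projections\<close>

lemma proj_perp_mult_vec:
  fixes A :: "real^'n^'m"
  shows "proj_perp A i *v u = u - (unit_row A i \<bullet> u) *\<^sub>R unit_row A i"
proof -
  have "(col_mat a ** transpose (col_mat a)) *v u = (a \<bullet> u) *\<^sub>R a" for a :: "real^'n"
    by (simp add: vec_eq_iff matrix_vector_mult_def matrix_matrix_mult_def col_mat_def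
        columnvector_def transpose_def inner_vec_def sum_distrib_left mult_ac)
  then show ?thesis
    by (simp add: proj_perp_def matrix_vector_mult_diff_rdistrib)
qed

lemma transpose_proj_perp: "transpose (proj_perp A i) = proj_perp A i"
  by (simp add: proj_perp_def vec_eq_iff matrix_matrix_mult_def col_mat_def
      columnvector_def transpose_def mat_def mult.commute)

locale nonzero_rows =
  fixes A :: "real^'n^'m"
  assumes row_nonzero: "A $ i \<noteq> 0"
begin

lemma unit_row_inner_self: "unit_row A i \<bullet> unit_row A i = 1"
  using row_nonzero[of i] by (simp add: unit_row_def dot_square_norm power2_eq_square)

lemma proj_perp_unit_row: "proj_perp A i *v unit_row A i = 0"
  by (simp add: proj_perp_mult_vec unit_row_inner_self)

lemma proj_perp_idem: "proj_perp A i ** proj_perp A i = proj_perp A i"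
  by (simp add: matrix_eq matrix_vector_mul_assoc[symmetric] proj_perp_mult_vec inner_diff_right
      unit_row_inner_self)

text \<open>Up to the row norms, the inner products are the entries of \<open>A *v u\<close>, and
  full column rank makes \<open>A\<close> injective.\<close>

lemma eq_0_if_orthogonal_rows:
  assumes "rank A = CARD('n)" and "\<And>i. unit_row A i \<bullet> u = 0"
  shows "u = 0"
proof -
  have "A $ i \<bullet> u = 0" for i
    using assms(2)[of i] row_nonzero[of i] by (simp add: unit_row_def)
  then have "A *v u = 0"
    by (simp add: vec_eq_iff matrix_vector_mul_component)
  with assms(1) show ?thesis by (metis full_rank_injective injD matrix_vector_mult_0_right)
qed

text \<open>The range of each projection is orthogonal to its row, so a common fixed vector is
  orthogonal to all rows.\<close>

lemma mean_P_contraction: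
  assumes "rank A = CARD('n)" "\<And>i. 0 < p i" "(\<Sum>i\<in>UNIV. p i) = 1"
  shows "\<exists>c. 0 \<le> c \<and> c < 1 \<and> (\<forall>w. norm (mean_P A p *v w) \<le> c * norm w)"
  unfolding mean_P_def
proof (rule mean_projection_contraction[OF assms(2,3) transpose_proj_perp proj_perp_idem])
  fix u assume fixed: "\<And>i. proj_perp A i *v u = u"
  show "u = 0"
  proof (rule eq_0_if_orthogonal_rows[OF assms(1)])
    fix i
    have "unit_row A i \<bullet> (proj_perp A i *v u) = 0"
      by (simp add: proj_perp_mult_vec inner_diff_right unit_row_inner_self)
    then show "unit_row A i \<bullet> u = 0" by (simp add: fixed)
  qed
qed

text \<open>The Kronecker square of an orthogonal projection is again one. For a common fixed vector
  \<open>w\<close>, each slice with the second index held constant is orthogonal to all rows, hence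
  zero.\<close>

lemma mean_Q_contraction:
  assumes "rank A = CARD('n)" "\<And>i. 0 < p i" "(\<Sum>i\<in>UNIV. p i) = 1"
  shows "\<exists>c. 0 \<le> c \<and> c < 1 \<and> (\<forall>w. norm (mean_Q A p *v w) \<le> c * norm w)"
  unfolding mean_Q_def
proof (rule mean_projection_contraction[OF assms(2,3)])
  show sym: "transpose (proj_perp A i \<otimes>\<^sub>K proj_perp A i) = proj_perp A i \<otimes>\<^sub>K proj_perp A i" for i
    by (simp add: transpose_kronecker transpose_proj_perp)
  show "(proj_perp A i \<otimes>\<^sub>K proj_perp A i) ** (proj_perp A i \<otimes>\<^sub>K proj_perp A i) =
      proj_perp A i \<otimes>\<^sub>K proj_perp A i" for i
    by (simp add: kronecker_mult proj_perp_idem)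
  fix w assume fixed: "\<And>i. (proj_perp A i \<otimes>\<^sub>K proj_perp A i) *v w = w"
  show "w = 0"
  proof -
    have "(\<chi> a. w $ (a, b)) = 0" for b
    proof (rule eq_0_if_orthogonal_rows[OF assms(1)])
      fix i
      \<comment> \<open>Test the fixed vector \<open>w\<close> against a vector that the symmetric operator annihilates.\<close>
      let ?v = "kronecker_vec (unit_row A i) (axis b 1)"
      have "?v \<bullet> w = ?v \<bullet> ((proj_perp A i \<otimes>\<^sub>K proj_perp A i) *v w)" using fixed by simp
      also have "\<dots> = ((proj_perp A i \<otimes>\<^sub>K proj_perp A i) *v ?v) \<bullet> w"
        by (rule symmetric_inner_shift[OF sym, symmetric])
      also have "\<dots> = 0"
        unfolding kronecker_mult_kronecker_vec proj_perp_unit_row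
        by (simp add: kronecker_vec_def inner_vec_def)
      \<comment> \<open>The factor \<open>axis b 1\<close> keeps only the entries of
        \<open>w\<close> with second index \<open>b\<close>.\<close>
      finally show "unit_row A i \<bullet> (\<chi> a. w $ (a, b)) = 0"
        by (simp add: inner_vec_def kronecker_vec_def sum_UNIV_prod axis_def if_distrib
            if_distribR cong: if_cong)
    qed
    then show ?thesis by (simp add: vec_eq_iff)
  qed
qed

text \<open>Since \<open>y = A *v x + \<eta>\<close>, the residual of row \<open>i\<close> equals
  the noise \<open>\<eta> $ i\<close> minus the inner product of the row with the error; the rest is
  normalisation.\<close>

lemma kaczmarz_error_step:
  assumes "y = A *v x + \<eta>"
  shows "kaczmarz A y x0 s (Suc k) - x =
    proj_perp A (s (Suc k)) *v (kaczmarz A y x0 s k - x) +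
      scaled_noise A \<eta> (s (Suc k)) *\<^sub>R unit_row A (s (Suc k))"
proof -
  define i where "i = s (Suc k)"
  define v where "v = kaczmarz A y x0 s k"
  have "y $ i - A $ i \<bullet> v = \<eta> $ i - A $ i \<bullet> (v - x)"
    by (simp add: assms matrix_vector_mul_component inner_diff_right)
  then have "kaczmarz A y x0 s (Suc k) - x =
      (v - x) + ((\<eta> $ i - A $ i \<bullet> (v - x)) / (norm (A $ i))\<^sup>2) *\<^sub>R A $ i"
    by (simp add: Let_def i_def v_def)
  also have "\<dots> = proj_perp A i *v (v - x) + scaled_noise A \<eta> i *\<^sub>R unit_row A i"
    by (simp add: proj_perp_mult_vec unit_row_def scaled_noise_def power2_eq_square
        diff_divide_distrib scaleR_diff_left)
  finally show ?thesis by (simp only: i_def v_def)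
qed

end

section \<open>Averaging one step over the choice of row\<close>

lemma mean_P_affine:
  "(\<Sum>i\<in>UNIV. p i *\<^sub>R (proj_perp A i *v u + scaled_noise A \<eta> i *\<^sub>R unit_row A i)) =
    mean_P A p *v u + mean_f A p \<eta>"
  by (simp add: mean_P_def mean_f_def mean_matrix_vector_mult scaleR_add_right sum.distrib)

text \<open>Here \<open>w\<close> is independent of \<open>u\<close>: it will be the mean of the
  Kronecker square of the error, which in general is not the Kronecker square of the mean.\<close>

lemma mean_Q_affine:
  "(\<Sum>i\<in>UNIV. p i *\<^sub>R
      ((proj_perp A i \<otimes>\<^sub>K proj_perp A i) *v w +
       scaled_noise A \<eta> i *\<^sub>R
         (kronecker_vec (unit_row A i) (proj_perp A i *v u) +
          kronecker_vec (proj_perp A i *v u) (unit_row A i)) +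
       (scaled_noise A \<eta> i)\<^sup>2 *\<^sub>R kronecker_vec (unit_row A i) (unit_row A i))) =
    mean_Q A p *v w + (mean_e A p \<eta> + mean_D A p \<eta> *v u)"
  by (simp add: mean_Q_def mean_D_def mean_e_def mean_matrix_vector_mult scaleR_add_right
      sum.distrib matrix_vector_mult_add_rdistrib kronecker_col_left kronecker_col_right
      column_kronecker_col_mat)

subsection \<open>Independence of the next row from the current iterate\<close>

text \<open>The discrete sigma-algebra makes every \<open>h\<close> measurable, and the largest of
  the finitely many norms bounds it.\<close>

lemma (in prob_space) integrable_finite_range:
  fixes h :: "'c \<Rightarrow> 'b::{banach, second_countable_topology}"
  assumes Y: "random_variable (count_space UNIV) Y" and fin: "finite (Y ` space M)"
  shows "integrable M (\<lambda>\<omega>. h (Y \<omega>))"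
proof -
  have "finite ((\<lambda>\<omega>. norm (h (Y \<omega>))) ` space M)"
    using finite_imageI[OF fin, of "\<lambda>u. norm (h u)"] by (simp add: image_image)
  then obtain B where "\<And>\<omega>. \<omega> \<in> space M \<Longrightarrow> norm (h (Y \<omega>)) \<le> B"
    by (metis Max_ge imageI)
  then show ?thesis
    using measurable_compose[OF Y, of h borel] by (intro integrable_const_bound[of _ B]) auto
qed

text \<open>
  Independence is stated through real functions of \<open>X\<close> and \<open>Y\<close> because \<open>indep_var\<close> needs
  both variables to have the same value type.
\<close>

lemma (in prob_space) expectation_indep_finite:
  fixes h :: "'i::finite \<Rightarrow> 'c \<Rightarrow> 'b::euclidean_space"
  assumes X: "random_variable (count_space UNIV) X"
    and Y: "random_variable (count_space UNIV) Y"
    and ind: "\<And>(\<phi> :: 'i \<Rightarrow> real) (\<psi> :: 'c \<Rightarrow> real).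
      indep_var borel (\<lambda>\<omega>. \<phi> (X \<omega>)) borel (\<lambda>\<omega>. \<psi> (Y \<omega>))"
    and fin: "finite (Y ` space M)"
  shows "expectation (\<lambda>\<omega>. h (X \<omega>) (Y \<omega>)) =
    (\<Sum>i\<in>UNIV. prob {\<omega> \<in> space M. X \<omega> = i} *\<^sub>R expectation (\<lambda>\<omega>. h i (Y \<omega>)))"
proof -
  have XY: "random_variable (count_space UNIV) (\<lambda>\<omega>. (X \<omega>, Y \<omega>))"
    by (rule measurable_compose_countable[where f = "\<lambda>i \<omega>. (i, Y \<omega>)", OF _ X])
      (rule measurable_compose[OF Y], simp)
  have "finite ((\<lambda>\<omega>. (X \<omega>, Y \<omega>)) ` space M)"
    by (rule finite_subset[of _ "UNIV \<times> Y ` space M"]) (auto simp: fin)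
  note int_XY = integrable_finite_range[OF XY this]
  note int_Y = integrable_finite_range[OF Y fin]
  show ?thesis
  \<comment> \<open>Passing to coordinates reduces the claim to real functions, for which
    independence gives a product of expectations.\<close>
  proof (rule euclidean_eqI)
    fix b :: 'b assume "b \<in> Basis"
    let ?I = "\<lambda>i \<omega>. of_bool (X \<omega> = i) :: real"
    have int_I: "integrable M (?I i)" for i
      using integrable_finite_range[OF X, of "\<lambda>j. of_bool (j = i) :: real"] by simp
    have exp_I: "expectation (?I i) = prob {\<omega> \<in> space M. X \<omega> = i}" for i
    proof -
      have "expectation (?I i) = expectation (indicator {\<omega> \<in> space M. X \<omega> = i})"
        by (intro Bochner_Integration.integral_cong) (auto simp: indicator_def)
      also have "\<dots> = prob {\<omega> \<in> space M. X \<omega> = i}"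
        by (simp add: Int_absorb2)
      finally show ?thesis .
    qed
    have indep_i: "indep_var borel (?I i) borel (\<lambda>\<omega>. h i (Y \<omega>) \<bullet> b)" for i
      by (rule ind)
    have int_hY: "integrable M (\<lambda>\<omega>. h i (Y \<omega>) \<bullet> b)" for i
      by (rule int_Y)
    have "expectation (\<lambda>\<omega>. h (X \<omega>) (Y \<omega>)) \<bullet> b = expectation (\<lambda>\<omega>. h (X \<omega>) (Y \<omega>) \<bullet> b)"
      using int_XY[of "\<lambda>r. h (fst r) (snd r)"] by simp
    \<comment> \<open>Splitting by the value of \<open>X\<close>: at each \<open>\<omega>\<close>
      exactly one indicator is 1.\<close>
    also have "\<dots> = expectation (\<lambda>\<omega>. \<Sum>i\<in>UNIV. ?I i \<omega> * (h i (Y \<omega>) \<bullet> b))"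
      by (simp add: of_bool_def if_distrib[where f = "\<lambda>t. t * _"] cong: if_cong)
    also have "\<dots> = (\<Sum>i\<in>UNIV. expectation (\<lambda>\<omega>. ?I i \<omega> * (h i (Y \<omega>) \<bullet> b)))"
      by (intro Bochner_Integration.integral_sum indep_var_integrable[OF indep_i] int_I int_hY)
    also have "\<dots> = (\<Sum>i\<in>UNIV. prob {\<omega> \<in> space M. X \<omega> = i} * expectation (\<lambda>\<omega>. h i (Y \<omega>) \<bullet> b))"
      by (simp add: indep_var_lebesgue_integral[OF indep_i int_I int_hY] exp_I)
    also have "\<dots> = (\<Sum>i\<in>UNIV. prob {\<omega> \<in> space M. X \<omega> = i} *\<^sub>R expectation (\<lambda>\<omega>. h i (Y \<omega>))) \<bullet> b"
      by (simp add: inner_sum_left int_Y)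
    finally show "expectation (\<lambda>\<omega>. h (X \<omega>) (Y \<omega>)) \<bullet> b = \<dots>" .
  qed
qed

section \<open>The iterates as discrete random variables\<close>

lemma kaczmarz_cong:
  assumes "\<And>j. 1 \<le> j \<Longrightarrow> j \<le> k \<Longrightarrow> s j = t j"
  shows "kaczmarz A y x0 s k = kaczmarz A y x0 t k"
  using assms by (induction k) (auto simp: Let_def)

text \<open>Presents the iterate as a function of the block of rows \<open>1..k\<close>, the form in
  which independence of disjoint blocks applies.\<close>

lemma kaczmarz_restrict: "kaczmarz A y x0 (restrict s {1..k}) k = kaczmarz A y x0 s k"
  by (rule kaczmarz_cong) auto

text \<open>From a fixed start, each step offers only finitely many rows, so there are finitely many
  paths of length \<open>k\<close>.\<close>

lemma finite_range_kaczmarz: "finite (range (\<lambda>s. kaczmarz A y x0 s k))"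
proof (induction k)
  case (Suc k)
  let ?step = "\<lambda>(i, u). u + ((y $ i - A $ i \<bullet> u) / (norm (A $ i))\<^sup>2) *\<^sub>R A $ i"
  have "range (\<lambda>s. kaczmarz A y x0 s (Suc k)) \<subseteq>
      ?step ` (UNIV \<times> range (\<lambda>s. kaczmarz A y x0 s k))"
    by (auto simp: Let_def image_iff)
  then show ?case by (rule finite_subset) (simp add: Suc)
qed simp

text \<open>\<open>J\<close> stays fixed while \<open>k\<close> grows, so one product space serves
  the whole induction. The discrete target lets arbitrary functions of the iterate be
  measurable.\<close>

lemma measurable_kaczmarz:
  assumes "{1..k} \<subseteq> J"
  shows "(\<lambda>s. kaczmarz A y x0 s k) \<in> PiM J (\<lambda>_. count_space UNIV) \<rightarrow>\<^sub>M count_space UNIV"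
  using assms
proof (induction k)
  case (Suc k)
  let ?step = "\<lambda>i u. u + ((y $ i - A $ i \<bullet> u) / (norm (A $ i))\<^sup>2) *\<^sub>R A $ i"
  have IH: "(\<lambda>s. kaczmarz A y x0 s k) \<in> PiM J (\<lambda>_. count_space UNIV) \<rightarrow>\<^sub>M count_space UNIV"
    using Suc.prems by (intro Suc.IH) auto
  have "(\<lambda>s. ?step i (kaczmarz A y x0 s k)) \<in> PiM J (\<lambda>_. count_space UNIV) \<rightarrow>\<^sub>M count_space UNIV"
    for i
    by (rule measurable_compose[OF IH]) simp
  moreover have "(\<lambda>s. s (Suc k)) \<in> PiM J (\<lambda>_. count_space UNIV) \<rightarrow>\<^sub>M count_space UNIV"
    using Suc.prems by (intro measurable_component_singleton) auto
  \<comment> \<open>The step is measurable for each constant row, and the row drawn takes finitely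
    many values.\<close>
  ultimately have "(\<lambda>s. ?step (s (Suc k)) (kaczmarz A y x0 s k))
      \<in> PiM J (\<lambda>_. count_space UNIV) \<rightarrow>\<^sub>M count_space UNIV"
    by (rule measurable_compose_countable)
  then show ?case by (simp add: Let_def)
qed simp

lemma (in prob_space) random_variable_kaczmarz:
  fixes idx :: "nat \<Rightarrow> 'a \<Rightarrow> 'm::finite"
  assumes "\<And>j. 1 \<le> j \<Longrightarrow> random_variable (count_space UNIV) (idx j)"
  shows "random_variable (count_space UNIV) (\<lambda>\<omega>. kaczmarz A y x0 (\<lambda>j. idx j \<omega>) k)"
proof -
  have "(\<lambda>\<omega>. restrict (\<lambda>j. idx j \<omega>) {1..k}) \<in> M \<rightarrow>\<^sub>M PiM {1..k} (\<lambda>_. count_space UNIV)"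
    using assms by (intro measurable_restrict) auto
  from measurable_compose[OF this measurable_kaczmarz[OF order_refl]]
  have "random_variable (count_space UNIV)
      (\<lambda>\<omega>. kaczmarz A y x0 (restrict (\<lambda>j. idx j \<omega>) {1..k}) k)" .
  then show ?thesis by (simp only: kaczmarz_restrict)
qed

text \<open>The next row and the current iterate depend on the disjoint index blocks
  \<open>{Suc k}\<close> and \<open>{1..k}\<close>.\<close>

lemma (in prob_space) indep_var_next_row_kaczmarz:
  fixes idx :: "nat \<Rightarrow> 'a \<Rightarrow> 'm::finite" and \<phi> :: "'m \<Rightarrow> real" and \<psi> :: "real^'n \<Rightarrow> real"
  assumes "indep_vars (\<lambda>_. count_space UNIV) idx {1..}"
  shows "indep_var borel (\<lambda>\<omega>. \<phi> (idx (Suc k) \<omega>))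
    borel (\<lambda>\<omega>. \<psi> (kaczmarz A y x0 (\<lambda>j. idx j \<omega>) k))"
proof -
  have "indep_var
      (PiM {Suc k} (\<lambda>_. count_space UNIV)) (\<lambda>\<omega>. restrict (\<lambda>j. idx j \<omega>) {Suc k})
      (PiM {1..k} (\<lambda>_. count_space UNIV)) (\<lambda>\<omega>. restrict (\<lambda>j. idx j \<omega>) {1..k})"
    by (rule indep_var_restrict[OF assms]) auto
  moreover have "(\<lambda>s. \<phi> (s (Suc k))) \<in> borel_measurable (PiM {Suc k} (\<lambda>_. count_space UNIV))"
    by (rule measurable_compose[OF measurable_component_singleton]) auto
  moreover have "(\<lambda>s. \<psi> (kaczmarz A y x0 s k)) \<in>
      borel_measurable (PiM {1..k} (\<lambda>_. count_space UNIV))"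
    by (rule measurable_compose[OF measurable_kaczmarz]) auto
  ultimately have "indep_var
      borel ((\<lambda>s. \<phi> (s (Suc k))) \<circ> (\<lambda>\<omega>. restrict (\<lambda>j. idx j \<omega>) {Suc k}))
      borel ((\<lambda>s. \<psi> (kaczmarz A y x0 s k)) \<circ> (\<lambda>\<omega>. restrict (\<lambda>j. idx j \<omega>) {1..k}))"
    by (rule indep_var_compose)
  then show ?thesis by (simp add: comp_def kaczmarz_restrict del: atLeastAtMost_iff One_nat_def)
qed

subsection \<open>The limiting mean squared error\<close>

text \<open>Invertibility is part of the conclusion so that both occurrences of
  \<open>matrix_inv\<close> denote genuine inverses.\<close>

theorem proposition2:
  fixes A :: "real^'n^'m"
    and p :: "'m \<Rightarrow> real"
    and x x0 :: "real^'n"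
    and \<eta> y :: "real^'m"
    and M :: "'w measure"
    and idx :: "nat \<Rightarrow> 'w \<Rightarrow> 'm"
  assumes tall: "CARD('n) \<le> CARD('m)"
    and full_rank: "rank A = CARD('n)"
    and nonzero_rows: "\<And>i. A $ i \<noteq> 0"
    and p_pos: "\<And>i. 0 < p i"
    and p_sum: "(\<Sum>i\<in>UNIV. p i) = 1"
    and y_eq: "y = A *v x + \<eta>"
    and prob: "prob_space M"
    and indep: "prob_space.indep_vars M (\<lambda>_. count_space UNIV) idx {1..}"
    and distr: "\<And>k i. 1 \<le> k \<Longrightarrow> measure M {\<omega> \<in> space M. idx k \<omega> = i} = p i"
  shows "invertible (mat 1 - mean_P A p) \<and>
    invertible (mat 1 - mean_Q A p) \<and>
    (let v2 = matrix_inv (mat 1 - mean_P A p) *v mean_f A p \<eta>;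
         v1 = matrix_inv (mat 1 - mean_Q A p) *v (mean_e A p \<eta> + mean_D A p \<eta> *v v2)
     in (\<lambda>k. prob_space.expectation M
              (\<lambda>\<omega>. (norm (kaczmarz A y x0 (\<lambda>j. idx j \<omega>) k - x))\<^sup>2))
          \<longlonglongrightarrow> trace (unstack_cols v1))"
proof -
  interpret prob_space M by (rule prob)
  interpret nonzero_rows A by standard (rule nonzero_rows)
  define v2 where "v2 = matrix_inv (mat 1 - mean_P A p) *v mean_f A p \<eta>"
  define v1 where
    "v1 = matrix_inv (mat 1 - mean_Q A p) *v (mean_e A p \<eta> + mean_D A p \<eta> *v v2)"
  define u where "u k \<omega> = kaczmarz A y x0 (\<lambda>j. idx j \<omega>) k" for k \<omega>
  define z where "z k \<omega> = u k \<omega> - x" for k \<omega>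
  define Z where "Z k \<omega> = kronecker_vec (z k \<omega>) (z k \<omega>)" for k \<omega>

  obtain cP where cP: "0 \<le> cP" "cP < 1" "\<And>w. norm (mean_P A p *v w) \<le> cP * norm w"
    using mean_P_contraction[OF full_rank p_pos p_sum] by metis
  obtain cQ where cQ: "0 \<le> cQ" "cQ < 1" "\<And>w. norm (mean_Q A p *v w) \<le> cQ * norm w"
    using mean_Q_contraction[OF full_rank p_pos p_sum] by metis

  have rv_idx: "random_variable (count_space UNIV) (idx k)" if "1 \<le> k" for k
    using indep that by (auto simp: indep_vars_def)
  have rv_u: "random_variable (count_space UNIV) (u k)" for k
    unfolding u_def by (rule random_variable_kaczmarz[OF rv_idx])
  have indep_u: "indep_var borel (\<lambda>\<omega>. \<phi> (idx (Suc k) \<omega>)) borel (\<lambda>\<omega>. \<psi> (u k \<omega>))"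
    for k and \<phi> :: "'m \<Rightarrow> real" and \<psi> :: "real^'n \<Rightarrow> real"
    unfolding u_def by (rule indep_var_next_row_kaczmarz[OF indep])
  have fin_u: "finite (u k ` space M)" for k
    by (rule finite_subset[OF _ finite_range_kaczmarz[of A y x0 k]]) (auto simp: u_def)
  note int_u = integrable_finite_range[OF rv_u fin_u]
  have int_z: "integrable M (z k)" and int_Z: "integrable M (Z k)" for k
    using int_u[where h = "\<lambda>u. u - x"] int_u[where h = "\<lambda>u. kronecker_vec (u - x) (u - x)"]
    by (simp_all add: z_def[abs_def] Z_def[abs_def])
  \<comment> \<open>The value type of \<open>h\<close> is left general: the mean needs vectors, the
    second moment their Kronecker squares.\<close>
  have step: "expectation (\<lambda>\<omega>. h (idx (Suc k) \<omega>) (u k \<omega>)) =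
      (\<Sum>i\<in>UNIV. p i *\<^sub>R expectation (\<lambda>\<omega>. h i (u k \<omega>)))"
    for k and h :: "'m \<Rightarrow> real^'n \<Rightarrow> 'b::euclidean_space"
    by (simp add: expectation_indep_finite[OF rv_idx rv_u indep_u fin_u] distr)
  have z_Suc: "z (Suc k) \<omega> = proj_perp A (idx (Suc k) \<omega>) *v z k \<omega> +
      scaled_noise A \<eta> (idx (Suc k) \<omega>) *\<^sub>R unit_row A (idx (Suc k) \<omega>)" for k \<omega>
    unfolding z_def u_def by (rule kaczmarz_error_step[OF y_eq])

  \<comment> \<open>These maps are matrix-vector products, hence bounded linear, and expectation
    passes through them.\<close>
  have bl_left: "bounded_linear (\<lambda>v. kronecker_vec a (L *v v))"
    and bl_right: "bounded_linear (\<lambda>v. kronecker_vec (L *v v) a)"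
    for a :: "real^'n" and L :: "real^'n^'n"
    unfolding kronecker_col_left[symmetric] kronecker_col_right[symmetric]
    by (rule matrix_vector_mul_bounded_linear)+

  have mean_step: "expectation (z (Suc k)) = mean_P A p *v expectation (z k) + mean_f A p \<eta>" for k
  proof -
    have "expectation (z (Suc k)) = (\<Sum>i\<in>UNIV. p i *\<^sub>R
        expectation (\<lambda>\<omega>. proj_perp A i *v z k \<omega> + scaled_noise A \<eta> i *\<^sub>R unit_row A i))"
      unfolding z_Suc[abs_def]
      using step[of "\<lambda>i v. proj_perp A i *v (v - x) + scaled_noise A \<eta> i *\<^sub>R unit_row A i" k]
      by (simp add: z_def)
    also have "\<dots> = (\<Sum>i\<in>UNIV. p i *\<^sub>R
        (proj_perp A i *v expectation (z k) + scaled_noise A \<eta> i *\<^sub>R unit_row A i))"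
      by (simp add: int_z integrable_bounded_linear[OF matrix_vector_mul_bounded_linear]
          integral_bounded_linear[OF matrix_vector_mul_bounded_linear] prob_space)
    finally show ?thesis by (simp only: mean_P_affine)
  qed

  have second_moment_step: "expectation (Z (Suc k)) = mean_Q A p *v expectation (Z k) +
      (mean_e A p \<eta> + mean_D A p \<eta> *v expectation (z k))" for k
  proof -
    \<comment> \<open>With the Kronecker square as a separate argument \<open>W\<close>, the
      quadratic update becomes affine in \<open>W\<close> and \<open>v\<close> jointly, so its
      expectation needs only the two means.\<close>
    let ?R = "\<lambda>i W v. (proj_perp A i \<otimes>\<^sub>K proj_perp A i) *v W +
       scaled_noise A \<eta> i *\<^sub>R
         (kronecker_vec (unit_row A i) (proj_perp A i *v v) +
          kronecker_vec (proj_perp A i *v v) (unit_row A i)) +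
       (scaled_noise A \<eta> i)\<^sup>2 *\<^sub>R kronecker_vec (unit_row A i) (unit_row A i)"
    have "Z (Suc k) \<omega> = ?R (idx (Suc k) \<omega>) (Z k \<omega>) (z k \<omega>)" for \<omega>
      unfolding Z_def z_Suc kronecker_vec_affine kronecker_mult_kronecker_vec ..
    then have "expectation (Z (Suc k)) =
        expectation (\<lambda>\<omega>. ?R (idx (Suc k) \<omega>) (Z k \<omega>) (z k \<omega>))" by presburger
    also have "\<dots> = (\<Sum>i\<in>UNIV. p i *\<^sub>R expectation (\<lambda>\<omega>. ?R i (Z k \<omega>) (z k \<omega>)))"
      using step[of "\<lambda>i v. ?R i (kronecker_vec (v - x) (v - x)) (v - x)" k]
      by (simp only: z_def Z_def)
    also have "\<dots> = (\<Sum>i\<in>UNIV. p i *\<^sub>R ?R i (expectation (Z k)) (expectation (z k)))"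
      by (simp add: int_z int_Z prob_space integrable_bounded_linear[OF bl_left]
          integrable_bounded_linear[OF bl_right]
          integrable_bounded_linear[OF matrix_vector_mul_bounded_linear]
          integral_bounded_linear[OF bl_left] integral_bounded_linear[OF bl_right]
          integral_bounded_linear[OF matrix_vector_mul_bounded_linear])
    finally show ?thesis by (simp only: mean_Q_affine)
  qed

  have mean_lim: "(\<lambda>k. expectation (z k)) \<longlonglongrightarrow> v2"
    unfolding v2_def by (rule affine_recursion_tendsto[OF cP]) (rule mean_step, rule tendsto_const)
  \<comment> \<open>The mean enters the second recursion only through its forcing term, which
    therefore converges.\<close>
  have "(\<lambda>k. mean_e A p \<eta> + mean_D A p \<eta> *v expectation (z k)) \<longlonglongrightarrow>
      mean_e A p \<eta> + mean_D A p \<eta> *v v2"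
    by (intro tendsto_intros bounded_linear.tendsto[OF matrix_vector_mul_bounded_linear] mean_lim)
  then have "(\<lambda>k. expectation (Z k)) \<longlonglongrightarrow> v1"
    unfolding v1_def by (rule affine_recursion_tendsto[OF cQ, rotated]) (rule second_moment_step)
  then have "(\<lambda>k. trace (unstack_cols (expectation (Z k)))) \<longlonglongrightarrow> trace (unstack_cols v1)"
    by (rule bounded_linear.tendsto[OF bounded_linear_trace_unstack_cols])
  \<comment> \<open>The trace is linear, so it commutes with expectation and turns the second moment
    into the mean squared error.\<close>
  moreover have "trace (unstack_cols (expectation (Z k))) = expectation (\<lambda>\<omega>. (norm (z k \<omega>))\<^sup>2)" for k
    using integral_bounded_linear[OF bounded_linear_trace_unstack_cols int_Z[of k]]
    by (simp add: Z_def trace_unstack_kronecker_vec)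
  ultimately have "(\<lambda>k. expectation (\<lambda>\<omega>. (norm (z k \<omega>))\<^sup>2)) \<longlonglongrightarrow> trace (unstack_cols v1)"
    by simp
  then show ?thesis
    using invertible_mat1_minus_contraction[OF cP(2,3)] invertible_mat1_minus_contraction[OF cQ(2,3)]
    unfolding Let_def z_def u_def v1_def v2_def by blast
qed

end
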